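(* Let $\mathcal{N}=(V,F)$ be a maximal directed mixed graph, let $\alpha,\beta\in V$, and assume that the bidirected edge $e$ between $\alpha$ and $\beta$ is in $\mathcal{N}$. Let $\mathcal{N}-e=(V,F\setminus\{e\})$. Then $\mathcal{N}-e$ is Markov equivalent to $\mathcal{N}$ if and only if $\alpha\in u(\beta,\mathcal{I}(\mathcal{N}-e))$ and $\beta\in u(\alpha,\mathcal{I}(\mathcal{N}-e))$.
   Context: A directed mixed graph (DMG) $\mathcal{G}=(V,E)$ has a finite node set $V$ and an edge set $E=E_d\sqcup E_b$, where $E_d$ is a set of ordered pairs of nodes (directed edges $\alpha\rightarrow\beta$, with $\alpha=\beta$ allowed) and $E_b$ is a set of unordered pairs (bidirected edges $\alpha\leftrightarrow\beta$, with $\alpha=\beta$ allowed). Several edges may be present between the same two nodes. The edge $\alpha\rightarrow\beta$ has a tail at $\alpha$ and a head at $\beta$; $\alpha\leftrightarrow\beta$ has heads at both ends. A walk is a sequence $\langle\gamma_1,e_1,\gamma_2,\ldots,e_n,\gamma_{n+1}\rangle$ with $e_i$ an edge between $\gamma_i$ and $\gamma_{i+1}$, together with an orientation of each directed loop on it (pointing towards $\gamma_1$ or towards $\gamma_{n+1}$); nodes and edges may repeat. It is nontrivial if $n\ge 1$. A non-endpoint occurrence $\gamma_i$ ($1<i<n+1$) is a collider if $e_{i-1}$ and $e_i$ both have heads at that occurrence, and otherwise a noncollider; endpoints are neither. For $C\subseteq V$, $An(C)$ is the set of nodes from which there is a directed path $\gamma\rightarrow\cdots\rightarrow c$ (possibly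 of length zero) to some $c\in C$; thus $C\subseteq An(C)$. A nontrivial walk from $\alpha$ to $\beta$ is $\mu$-connecting given $C$ if $\alpha\notin C$, every collider is in $An(C)$, no noncollider is in $C$, and the last edge has a head at (the final) $\beta$. For $A,B,C\subseteq V$ (not necessarily disjoint), $B$ is $\mu$-separated from $A$ given $C$ if there is no $\mu$-connecting walk from any $\alpha\in A$ to any $\beta\in B$ given $C$. $\mathcal{I}(\mathcal{G})$ is the set of triples $\langle A,B\mid C\rangle$ of subsets of $V$ such that $B$ is $\mu$-separated from $A$ given $C$ in $\mathcal{G}$. DMGs $\mathcal{G}_1,\mathcal{G}_2$ on the same node set are Markov equivalent if $\mathcal{I}(\mathcal{G}_1)=\mathcal{I}(\mathcal{G}_2)$. A DMG is maximal if it is complete (contains all possible directed and bidirected edges, including loops, on $V$), or if adding any edge not already present changes the induced independence model $\mathcal{I}(\cdot)$. For an independence model $\mathcal{I}$ over $V$ (a set of triples of subsets of $V$), $u(\beta,\mathcal{I})$ is the set of $\gamma\in V$ for which there is no $C\subseteq V\setminus\{\gamma\}$ with $\langle\{\gamma\},\{\beta\}\mid C\rangle\in\mathcal{I}$. *)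

theory Defs
  imports Main "HOL-Library.Uprod"
begin

datatype 'a edge = Dir 'a 'a | Bidir "'a uprod"

record 'a dmg =
  nodes :: "'a set"
  edges :: "'a edge set"

definition all_edges :: "'a set \<Rightarrow> 'a edge set" where
  "all_edges V = {Dir a b | a b. a \<in> V \<and> b \<in> V} \<union> {Bidir (Upair a b) | a b. a \<in> V \<and> b \<in> V}"

definition wf_dmg :: "'a dmg \<Rightarrow> bool" where
  "wf_dmg G \<longleftrightarrow> finite (nodes G) \<and> edges G \<subseteq> all_edges (nodes G)"

text \<open>A walk is given by its nodes \<open>vs = [v\<^sub>0, \<dots>, v\<^sub>n]\<close> and a list of steps \<open>[s\<^sub>0, \<dots>, s\<^sub>n\<^sub>-\<^sub>1]\<close>,
  where \<open>s\<^sub>i\<close> says how an edge is traversed from \<open>v\<^sub>i\<close> to \<open>v\<^sub>i\<^sub>+\<^sub>1\<close>. The step and the two nodes determine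
  the edge. For a directed loop, \<open>Fwd\<close> and \<open>Bwd\<close> are its two orientations: pointing towards the end,
  respectively the start, of the walk. Heads are attached to the two ends of a step and not to
  nodes, so that both occurrences of a node on either side of a loop are told apart.\<close>

datatype step = Fwd | Bwd | Both

fun step_edge :: "step \<Rightarrow> 'a \<Rightarrow> 'a \<Rightarrow> 'a edge" where
  "step_edge Fwd a b = Dir a b"
| "step_edge Bwd a b = Dir b a"
| "step_edge Both a b = Bidir (Upair a b)"

definition head_at_start :: "step \<Rightarrow> bool" where
  "head_at_start s \<longleftrightarrow> s = Bwd \<or> s = Both"

definition head_at_end :: "step \<Rightarrow> bool" where
  "head_at_end s \<longleftrightarrow> s = Fwd \<or> s = Both"

definition is_walk :: "'a dmg \<Rightarrow> 'a list \<Rightarrow> step list \<Rightarrow> bool" where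
  "is_walk G vs ss \<longleftrightarrow> length vs = Suc (length ss) \<and> set vs \<subseteq> nodes G \<and>
     (\<forall>i < length ss. step_edge (ss ! i) (vs ! i) (vs ! Suc i) \<in> edges G)"

text \<open>Colliders and noncolliders are positions on a walk, never its endpoints.\<close>

definition collider :: "step list \<Rightarrow> nat \<Rightarrow> bool" where
  "collider ss i \<longleftrightarrow> 0 < i \<and> i < length ss \<and> head_at_end (ss ! (i - 1)) \<and> head_at_start (ss ! i)"

definition noncollider :: "step list \<Rightarrow> nat \<Rightarrow> bool" where
  "noncollider ss i \<longleftrightarrow> 0 < i \<and> i < length ss \<and> \<not> collider ss i"

definition An :: "'a dmg \<Rightarrow> 'a set \<Rightarrow> 'a set" where
  "An G C = {v \<in> nodes G. \<exists>c\<in>C. (v, c) \<in> {(a, b). Dir a b \<in> edges G}\<^sup>*}"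

definition mu_connecting :: "'a dmg \<Rightarrow> 'a \<Rightarrow> 'a \<Rightarrow> 'a set \<Rightarrow> 'a list \<Rightarrow> step list \<Rightarrow> bool" where
  "mu_connecting G \<alpha> \<beta> C vs ss \<longleftrightarrow>
     is_walk G vs ss \<and> ss \<noteq> [] \<and> hd vs = \<alpha> \<and> last vs = \<beta> \<and> \<alpha> \<notin> C \<and>
     (\<forall>i. collider ss i \<longrightarrow> vs ! i \<in> An G C) \<and>
     (\<forall>i. noncollider ss i \<longrightarrow> vs ! i \<notin> C) \<and>
     head_at_end (last ss)"

definition mu_separated :: "'a dmg \<Rightarrow> 'a set \<Rightarrow> 'a set \<Rightarrow> 'a set \<Rightarrow> bool" where
  "mu_separated G A B C \<longleftrightarrow> \<not> (\<exists>\<alpha>\<in>A. \<exists>\<beta>\<in>B. \<exists>vs ss. mu_connecting G \<alpha> \<beta> C vs ss)"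

text \<open>A triple \<open>(A, B, C)\<close> in the independence model says that \<open>B\<close> is separated from \<open>A\<close> given \<open>C\<close>.\<close>

type_synonym 'a indep_model = "('a set \<times> 'a set \<times> 'a set) set"

definition indep_model :: "'a dmg \<Rightarrow> 'a indep_model" where
  "indep_model G = {(A, B, C). A \<subseteq> nodes G \<and> B \<subseteq> nodes G \<and> C \<subseteq> nodes G \<and> mu_separated G A B C}"

definition markov_equivalent :: "'a dmg \<Rightarrow> 'a dmg \<Rightarrow> bool" where
  "markov_equivalent G H \<longleftrightarrow> nodes G = nodes H \<and> indep_model G = indep_model H"

definition add_edge :: "'a dmg \<Rightarrow> 'a edge \<Rightarrow> 'a dmg" where
  "add_edge G e = G\<lparr>edges := insert e (edges G)\<rparr>"

definition del_edge :: "'a dmg \<Rightarrow> 'a edge \<Rightarrow> 'a dmg" where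
  "del_edge G e = G\<lparr>edges := edges G - {e}\<rparr>"

definition complete_dmg :: "'a dmg \<Rightarrow> bool" where
  "complete_dmg G \<longleftrightarrow> edges G = all_edges (nodes G)"

definition maximal_dmg :: "'a dmg \<Rightarrow> bool" where
  "maximal_dmg G \<longleftrightarrow> complete_dmg G \<or>
     (\<forall>e \<in> all_edges (nodes G) - edges G. indep_model (add_edge G e) \<noteq> indep_model G)"

definition u :: "'a set \<Rightarrow> 'a \<Rightarrow> 'a indep_model \<Rightarrow> 'a set" where
  "u V \<beta> I = {\<gamma> \<in> V. \<not> (\<exists>C. C \<subseteq> V - {\<gamma>} \<and> ({\<gamma>}, {\<beta>}, C) \<in> I)}"

end

theory Submission
  imports Defs
begin

text \<open>The direction from equivalence to \<open>u\<close> holds because a bidirected edge is itself a connecting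
  walk. For the converse, a connecting walk of \<open>N\<close> is rewritten from left to right, replacing
  each traversal of \<open>e\<close> from \<open>\<alpha>\<close> to \<open>\<beta>\<close>. If \<open>\<alpha> \<notin> C\<close>, the hypothesis on \<open>u\<close> supplies a
  substitute. If \<open>\<alpha> \<in> C\<close>, the walk reaches \<open>\<alpha>\<close> with a head and there are two cases. When \<open>\<alpha>\<close> is an
  ancestor of \<open>\<beta>\<close>, maximality lets the last edge be redirected from \<open>\<alpha>\<close> to \<open>\<beta>\<close>. When it is not,
  the hypothesis on \<open>u\<close>, applied to the ancestors of \<open>{\<alpha>, \<beta>}\<close>, together with maximality yields an
  inducing path in \<open>N - e\<close> that consists of bidirected edges only, and it replaces \<open>e\<close>.\<close>

section \<open>Open walks\<close>

text \<open>The flag \<open>c\<close> tells whether the walk passes \<open>x\<close> as a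
  collider.\<close>

definition passable :: "'a dmg \<Rightarrow> 'a set \<Rightarrow> 'a \<Rightarrow> bool \<Rightarrow> bool" where
  "passable G C x c \<longleftrightarrow> (if c then x \<in> An G C else x \<notin> C)"

text \<open>The Boolean arguments record whether the walk has a head at its start and at its end.
  Nothing is required of the endpoints, so open walks compose at any passable node.\<close>

inductive open_walk :: "'a dmg \<Rightarrow> 'a set \<Rightarrow> 'a \<Rightarrow> bool \<Rightarrow> 'a \<Rightarrow> bool \<Rightarrow> bool"
  for G :: "'a dmg" and C :: "'a set" where
  single: "step_edge s a b \<in> edges G \<Longrightarrow> open_walk G C a (head_at_start s) b (head_at_end s)"
| snoc: "open_walk G C a h x k \<Longrightarrow> step_edge s x b \<in> edges G \<Longrightarrow>
    passable G C x (k \<and> head_at_start s) \<Longrightarrow> open_walk G C a h b (head_at_end s)"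

lemmas head_defs = head_at_start_def head_at_end_def

lemma open_walk_Dir: "Dir a b \<in> edges G \<Longrightarrow> open_walk G C a False b True"
  using single[of Fwd a b G C] by (simp add: head_defs)

lemma open_walk_Bidir: "Bidir (Upair a b) \<in> edges G \<Longrightarrow> open_walk G C a True b True"
  using single[of Both a b G C] by (simp add: head_defs)

text \<open>Steps can only be appended, so the induction runs over the second walk, which is
  therefore the first premise.\<close>

lemma open_walk_trans:
  assumes "open_walk G C x k' b l" "open_walk G C a h x k" "passable G C x (k \<and> k')"
  shows "open_walk G C a h b l"
  using assms by (induction rule: open_walk.induct) (auto intro: snoc)

fun reverse_step :: "step \<Rightarrow> step" where
  "reverse_step Fwd = Bwd" | "reverse_step Bwd = Fwd" | "reverse_step Both = Both"

lemma reverse_step_simps: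
  "step_edge (reverse_step s) b a = step_edge s a b"
  "head_at_start (reverse_step s) = head_at_end s"
  "head_at_end (reverse_step s) = head_at_start s"
  by (cases s; auto simp: head_defs)+

lemma open_walk_sym:
  assumes "open_walk G C a h b k"
  shows "open_walk G C b k a h"
  using assms
proof (induction rule: open_walk.induct)
  case (single s a b)
  then show ?case
    using open_walk.single[of "reverse_step s" b a G C] by (simp add: reverse_step_simps)
next
  case (snoc a h x k s b)
  have "open_walk G C b (head_at_end s) x (head_at_start s)"
    using open_walk.single[of "reverse_step s" b x G C] snoc by (simp add: reverse_step_simps)
  then show ?case
    using open_walk_trans[OF snoc.IH] snoc.hyps by (simp add: conj_commute)
qed

text \<open>Substitutes with the same heads at both ends keep colliders colliders and noncolliders
  noncolliders; the inclusion of ancestors keeps the colliders passable.\<close>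

lemma open_walk_subst:
  assumes "open_walk G C a h b k" "An G C \<subseteq> An H C"
    and "\<And>s x y. step_edge s x y \<in> edges G \<Longrightarrow>
           open_walk H C x (head_at_start s) y (head_at_end s)"
  shows "open_walk H C a h b k"
  using assms(1)
proof (induction rule: open_walk.induct)
  case (single s a b)
  then show ?case by (rule assms(3))
next
  case (snoc a h x k s b)
  then have "passable H C x (k \<and> head_at_start s)"
    using assms(2) by (auto simp: passable_def split: if_splits)
  then show ?case
    using open_walk_trans[OF assms(3)] snoc by blast
qed

section \<open>Open walks and walks given by lists\<close>

lemma open_walk_imp_walk:
  assumes "open_walk G C a h b k" "wf_dmg G"
  shows "\<exists>vs ss. is_walk G vs ss \<and> ss \<noteq> [] \<and> hd vs = a \<and> last vs = b \<and> head_at_end (last ss) = k \<and>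
     (\<forall>i. collider ss i \<longrightarrow> vs ! i \<in> An G C) \<and> (\<forall>i. noncollider ss i \<longrightarrow> vs ! i \<notin> C)"
  using assms(1)
proof (induction rule: open_walk.induct)
  case (single s a b)
  then have "a \<in> nodes G \<and> b \<in> nodes G"
    using assms(2) by (cases s) (auto simp: wf_dmg_def all_edges_def)
  then show ?case
    using single
    by (intro exI[of _ "[a, b]"] exI[of _ "[s]"])
       (auto simp: is_walk_def collider_def noncollider_def)
next
  case (snoc a h x k s b)
  then obtain vs ss where w: "is_walk G vs ss" "ss \<noteq> []" "hd vs = a" "last vs = x"
    "head_at_end (last ss) = k" "\<And>i. collider ss i \<Longrightarrow> vs ! i \<in> An G C"
    "\<And>i. noncollider ss i \<Longrightarrow> vs ! i \<notin> C" by blast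
  have b: "b \<in> nodes G"
    using assms(2) snoc.hyps by (cases s) (auto simp: wf_dmg_def all_edges_def)
  have len: "length vs = Suc (length ss)" using w(1) by (simp add: is_walk_def)
  have lastx: "vs ! length ss = x"
    using w(4) len by (metis diff_Suc_1 last_conv_nth list.size(3) nat.distinct(1))
  have lasts: "ss ! (length ss - 1) = last ss" using w(2) by (simp add: last_conv_nth)
  have walk: "is_walk G (vs @ [b]) (ss @ [s])"
    using w(1) b len lastx snoc.hyps by (auto simp: is_walk_def nth_append less_Suc_eq)
  \<comment> \<open>The former endpoint is the only position that becomes interior.\<close>
  have end_coll: "collider (ss @ [s]) (length ss) \<longleftrightarrow> k \<and> head_at_start s"
    using w(2,5) lasts by (auto simp: collider_def nth_append)
  have old_coll: "collider (ss @ [s]) i \<longleftrightarrow> collider ss i" if "i < length ss" for i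
    using that by (auto simp: collider_def nth_append)
  have bounds: "(collider (ss @ [s]) i \<or> noncollider (ss @ [s]) i) \<Longrightarrow> i < length ss \<or> i = length ss"
    for i by (auto simp: collider_def noncollider_def)
  have "(vs @ [b]) ! i \<in> An G C" if "collider (ss @ [s]) i" for i
    using that bounds[of i] old_coll[of i] end_coll snoc.hyps(3) w(6)[of i] len lastx
    by (auto simp: nth_append passable_def)
  moreover have "(vs @ [b]) ! i \<notin> C" if "noncollider (ss @ [s]) i" for i
    using that bounds[of i] old_coll[of i] end_coll snoc.hyps(3) w(7)[of i] len lastx
    by (auto simp: nth_append passable_def noncollider_def split: if_splits)
  ultimately show ?case
    using walk w(3) len
    by (intro exI[of _ "vs @ [b]"] exI[of _ "ss @ [s]"]) (auto simp: hd_append)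
qed

lemma walk_imp_open_walk:
  assumes "is_walk G vs ss" "n < length ss"
    and "\<And>i. collider ss i \<Longrightarrow> vs ! i \<in> An G C" "\<And>i. noncollider ss i \<Longrightarrow> vs ! i \<notin> C"
  shows "open_walk G C (vs ! 0) (head_at_start (ss ! 0)) (vs ! Suc n) (head_at_end (ss ! n))"
  using assms(2)
proof (induction n)
  case 0
  then show ?case using assms(1) by (auto simp: is_walk_def intro!: single)
next
  case (Suc n)
  have "passable G C (vs ! Suc n) (head_at_end (ss ! n) \<and> head_at_start (ss ! Suc n))"
    using assms(3,4)[of "Suc n"] Suc.prems
    by (auto simp: passable_def collider_def noncollider_def)
  then show ?case
    using Suc assms(1) by (auto simp: is_walk_def intro!: snoc[of _ _ _ _ "vs ! Suc n"])
qed

lemma mu_connecting_iff_open_walk: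
  assumes "wf_dmg G"
  shows "(\<exists>vs ss. mu_connecting G a b C vs ss) \<longleftrightarrow> a \<notin> C \<and> (\<exists>h. open_walk G C a h b True)"
proof
  assume "\<exists>vs ss. mu_connecting G a b C vs ss"
  then obtain vs ss where m: "mu_connecting G a b C vs ss" by blast
  then have ss: "ss \<noteq> []" "length vs = Suc (length ss)"
    by (auto simp: mu_connecting_def is_walk_def)
  then have "vs \<noteq> []" by auto
  then have "vs ! 0 = a" "vs ! Suc (length ss - 1) = b" "head_at_end (ss ! (length ss - 1))"
    using m ss by (auto simp: mu_connecting_def hd_conv_nth last_conv_nth)
  moreover have "open_walk G C (vs ! 0) (head_at_start (ss ! 0)) (vs ! Suc (length ss - 1))
      (head_at_end (ss ! (length ss - 1)))"
    using m ss by (intro walk_imp_open_walk) (auto simp: mu_connecting_def)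
  moreover have "a \<notin> C" using m by (simp add: mu_connecting_def)
  ultimately show "a \<notin> C \<and> (\<exists>h. open_walk G C a h b True)" by auto
next
  assume "a \<notin> C \<and> (\<exists>h. open_walk G C a h b True)"
  then show "\<exists>vs ss. mu_connecting G a b C vs ss"
    using open_walk_imp_walk[OF _ assms] unfolding mu_connecting_def by metis
qed

text \<open>The head at the start is quantified separately on each side: mu-connection constrains
  only the final one, so a substitute walk may change it.\<close>

lemma indep_model_cong:
  assumes "wf_dmg G" "wf_dmg H" "nodes G = nodes H"
    and "\<And>a b C. a \<notin> C \<Longrightarrow> C \<subseteq> nodes G \<Longrightarrow>
      (\<exists>h. open_walk G C a h b True) \<longleftrightarrow> (\<exists>h. open_walk H C a h b True)"
  shows "indep_model G = indep_model H"
proof -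
  have "(\<exists>vs ss. mu_connecting G a b C vs ss) \<longleftrightarrow> (\<exists>vs ss. mu_connecting H a b C vs ss)"
    if "C \<subseteq> nodes G" for a b C
    using assms that by (metis mu_connecting_iff_open_walk)
  then have "mu_separated G A B C \<longleftrightarrow> mu_separated H A B C" if "C \<subseteq> nodes G" for A B C
    using that by (simp add: mu_separated_def)
  then show ?thesis
    using assms(3) by (auto simp: indep_model_def)
qed

lemma in_u_iff:
  assumes "wf_dmg G" "a \<in> nodes G" "b \<in> nodes G"
  shows "a \<in> u (nodes G) b (indep_model G) \<longleftrightarrow>
    (\<forall>C \<subseteq> nodes G - {a}. \<exists>h. open_walk G C a h b True)"
proof -
  have "C \<subseteq> nodes G - {a} \<and> ({a}, {b}, C) \<in> indep_model G \<longleftrightarrow>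
      C \<subseteq> nodes G - {a} \<and> \<not> (\<exists>h. open_walk G C a h b True)" for C
    using assms mu_connecting_iff_open_walk[OF assms(1), of a b C]
    by (auto simp: indep_model_def mu_separated_def)
  then show ?thesis using assms(2) unfolding u_def by blast
qed

lemma Bidir_imp_in_u:
  assumes "wf_dmg G" "Bidir (Upair a b) \<in> edges G"
  shows "a \<in> u (nodes G) b (indep_model G)"
proof -
  have "a \<in> nodes G \<and> b \<in> nodes G"
    using assms by (auto simp: wf_dmg_def all_edges_def)
  then show ?thesis using assms open_walk_Bidir by (fastforce simp: in_u_iff)
qed

section \<open>Ancestors and inducing paths\<close>

lemma An_trans: "x \<in> An G A \<Longrightarrow> A \<subseteq> An G C \<Longrightarrow> x \<in> An G C"
  unfolding An_def by (clarsimp simp: subset_iff) (meson rtrancl_trans)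

lemma An_mono: "A \<subseteq> C \<Longrightarrow> An G A \<subseteq> An G C"
  by (auto simp: An_def)

lemma An_self: "x \<in> nodes G \<Longrightarrow> x \<in> C \<Longrightarrow> x \<in> An G C"
  by (auto simp: An_def)

lemma An_nodes: "x \<in> An G C \<Longrightarrow> x \<in> nodes G"
  by (simp add: An_def)

lemma An_insert: "An G (insert x A) = An G {x} \<union> An G A"
  by (auto simp: An_def)

lemma An_step: "Dir a b \<in> edges G \<Longrightarrow> b \<in> An G C \<Longrightarrow> wf_dmg G \<Longrightarrow> a \<in> An G C"
  by (auto simp: An_def wf_dmg_def all_edges_def intro: converse_rtrancl_into_rtrancl)

lemma An_cong_Dir:
  assumes "nodes G = nodes H" "\<And>a b. Dir a b \<in> edges G \<longleftrightarrow> Dir a b \<in> edges H"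
  shows "An G C = An H C"
  using assms by (simp add: An_def)

text \<open>A node of \<open>C\<close> on a directed path from \<open>v\<close> would make
  \<open>v\<close> an ancestor of \<open>C\<close>, so the inner nodes of the path are noncolliders
  that do not block.\<close>

lemma open_walk_descend:
  assumes "v \<in> An G {b}" "v \<notin> An G C"
  shows "v = b \<or> open_walk G C v False b True"
proof -
  have "(v, b) \<in> {(a, b). Dir a b \<in> edges G}\<^sup>*" and v: "v \<in> nodes G"
    using assms(1) by (auto simp: An_def)
  then show ?thesis
  proof (induction rule: rtrancl_induct)
    case base
    then show ?case by simp
  next
    case (step w z)
    have "w \<notin> C" using assms(2) step.hyps(1) v by (auto simp: An_def)
    then show ?case
      using step open_walk_Dir[of w z G C] open_walk_trans[of G C w False z True v False True]
      by (auto simp: passable_def)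
  qed
qed

text \<open>A pair \<open>(a, b)\<close> in the transitive closure for
  \<open>S = An G {a, b}\<close> is joined by an inducing path of bidirected edges. The reflexive
  closure would not do, as it contains \<open>(a, a)\<close> even without an edge.\<close>

definition bidir_on :: "'a dmg \<Rightarrow> 'a set \<Rightarrow> 'a rel" where
  "bidir_on G S = {(a, b). Bidir (Upair a b) \<in> edges G \<and> a \<in> S \<and> b \<in> S}"

lemma bidir_on_sym: "(a, b) \<in> bidir_on G S \<Longrightarrow> (b, a) \<in> bidir_on G S"
  unfolding bidir_on_def by (simp, metis Upair_inject)

lemma bidir_on_rtrancl_sym: "(a, b) \<in> (bidir_on G S)\<^sup>* \<Longrightarrow> (b, a) \<in> (bidir_on G S)\<^sup>*"
  by (metis bidir_on_sym sym_def sym_rtrancl)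

lemma bidir_on_mono: "S \<subseteq> T \<Longrightarrow> edges G \<subseteq> edges H \<Longrightarrow> bidir_on G S \<subseteq> bidir_on H T"
  by (auto simp: bidir_on_def)

text \<open>A node outside \<open>An G C\<close> blocks the bidirected path, but from there one can descend to \<open>b\<close>,
  or start afresh by ascending to it from \<open>a\<close>.\<close>

lemma open_walk_bidirected_inducing:
  assumes "(a, b) \<in> (bidir_on G (An G {a, b}))\<^sup>+"
  shows "open_walk G C a True b True"
proof -
  \<comment> \<open>The first alternative absorbs a descent that has already reached
    \<open>b\<close>.\<close>
  have "open_walk G C a True b True \<or> open_walk G C a True v True"
    if "(a, v) \<in> (bidir_on G (An G {a, b}))\<^sup>+" for v
    using that
  proof (induction rule: trancl_induct)
    case (base v)
    then show ?case by (auto simp: bidir_on_def intro: open_walk_Bidir)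
  next
    case (step v w)
    have vw: "open_walk G C v True w True" and v: "v \<in> An G {a} \<or> v \<in> An G {b}"
      using step.hyps(2) An_insert[of G a "{b}"] by (auto simp: bidir_on_def intro: open_walk_Bidir)
    show ?case
    proof (cases "v \<in> An G C")
      case True
      then show ?thesis
        using step.IH open_walk_trans[OF vw, of a True True] by (auto simp: passable_def)
    next
      case False
      then have "v \<notin> C" using v by (auto simp: An_def)
      show ?thesis
        using v
      proof
        assume "v \<in> An G {a}"
        then show ?thesis
          using open_walk_descend[OF _ False] vw open_walk_sym
            open_walk_trans[OF vw, of a True False] \<open>v \<notin> C\<close>
          by (fastforce simp: passable_def)
      next
        assume "v \<in> An G {b}"
        then show ?thesis
          using open_walk_descend[OF _ False] step.IH \<open>v \<notin> C\<close>
            open_walk_trans[of G C v False b True a True True]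
          by (auto simp: passable_def)
      qed
    qed
  qed
  then show ?thesis using assms by blast
qed

text \<open>On \<open>a -> x <-> b\<close> the node \<open>x\<close> is a collider. If it blocks, it
  is no ancestor of \<open>C\<close>, and a directed path from \<open>x\<close> to \<open>b\<close>
  replaces the second edge.\<close>

lemma open_walk_directed_inducing:
  assumes "Dir a x \<in> edges G" "Bidir (Upair x b) \<in> edges G" "x \<in> An G {b}"
  shows "open_walk G C a False b True"
proof (cases "x \<in> An G C")
  case True
  then show ?thesis
    using open_walk_trans[OF open_walk_Bidir[OF assms(2)] open_walk_Dir[OF assms(1)]]
    by (simp add: passable_def)
next
  case False
  then have "x \<notin> C" using assms(3) by (auto simp: An_def)
  then show ?thesis
    using open_walk_descend[OF assms(3) False] open_walk_Dir[OF assms(1)]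
      open_walk_trans[of G C x False b True a False True]
    by (auto simp: passable_def)
qed

section \<open>Edges of maximal graphs\<close>

text \<open>If ancestors stay the same and every traversal of \<open>f\<close>, in either direction,
  has an open substitute with the same heads, then adding \<open>f\<close> cannot change the
  independence model.\<close>

lemma maximal_edgeI:
  assumes "wf_dmg G" "maximal_dmg G" "f \<in> all_edges (nodes G)"
    and An: "\<And>C. An (add_edge G f) C = An G C"
    and walk: "\<And>C s x y. step_edge s x y = f \<Longrightarrow>
      open_walk G C x (head_at_start s) y (head_at_end s)"
  shows "f \<in> edges G"
proof -
  have wf: "wf_dmg (add_edge G f)" and nodes: "nodes (add_edge G f) = nodes G"
    and edges: "edges (add_edge G f) = insert f (edges G)"
    using assms(1,3) by (auto simp: wf_dmg_def add_edge_def)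
  have "open_walk (add_edge G f) C a h b k \<longleftrightarrow> open_walk G C a h b k" for C a h b k
  proof
    assume "open_walk (add_edge G f) C a h b k"
    then show "open_walk G C a h b k"
      by (rule open_walk_subst) (auto simp: An edges intro: walk single)
  next
    assume "open_walk G C a h b k"
    then show "open_walk (add_edge G f) C a h b k"
      by (rule open_walk_subst) (auto simp: An edges intro: single)
  qed
  then have "indep_model (add_edge G f) = indep_model G"
    using indep_model_cong[OF wf assms(1) nodes] by simp
  then show ?thesis
    using assms(2,3) by (auto simp: maximal_dmg_def complete_dmg_def)
qed

lemma maximal_BidirI:
  assumes "wf_dmg G" "maximal_dmg G" "(a, b) \<in> (bidir_on G (An G {a, b}))\<^sup>+"
  shows "Bidir (Upair a b) \<in> edges G"
proof (rule maximal_edgeI[OF assms(1,2)])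
  have "a \<in> An G {a, b}" "b \<in> An G {a, b}"
    using assms(3) by (auto simp: bidir_on_def dest: tranclD tranclD2)
  then show "Bidir (Upair a b) \<in> all_edges (nodes G)" by (auto simp: all_edges_def An_def)
next
  show "An (add_edge G (Bidir (Upair a b))) C = An G C" for C
    by (rule An_cong_Dir) (auto simp: add_edge_def)
next
  fix C s x y
  assume "step_edge s x y = Bidir (Upair a b)"
  then have "s = Both" "x = a \<and> y = b \<or> x = b \<and> y = a" by (cases s; auto)+
  then show "open_walk G C x (head_at_start s) y (head_at_end s)"
    using open_walk_bidirected_inducing[OF assms(3), of C] open_walk_sym
    by (auto simp: head_defs)
qed

lemma maximal_DirI:
  assumes "wf_dmg G" "maximal_dmg G"
    and "Dir a x \<in> edges G" "Bidir (Upair x b) \<in> edges G" "x \<in> An G {b}"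
  shows "Dir a b \<in> edges G"
proof (rule maximal_edgeI[OF assms(1,2)])
  show "Dir a b \<in> all_edges (nodes G)"
    using assms(1,3,4) by (auto simp: wf_dmg_def all_edges_def)
next
  \<comment> \<open>As \<open>a\<close> already reaches \<open>b\<close> through \<open>x\<close>,
    the new directed edge creates no new ancestors.\<close>
  have "(a, b) \<in> {(a, b). Dir a b \<in> edges G}\<^sup>*"
    using assms(3,5) by (auto simp: An_def intro: converse_rtrancl_into_rtrancl)
  then have "{(x, y). Dir x y \<in> edges (add_edge G (Dir a b))}\<^sup>* = {(x, y). Dir x y \<in> edges G}\<^sup>*"
    by (intro rtrancl_subset) (auto simp: add_edge_def)
  then show "An (add_edge G (Dir a b)) C = An G C" for C
    by (simp add: An_def) (simp add: add_edge_def)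
next
  fix C s x' y
  assume "step_edge s x' y = Dir a b"
  then have "s = Fwd \<and> x' = a \<and> y = b \<or> s = Bwd \<and> x' = b \<and> y = a" by (cases s) auto
  then show "open_walk G C x' (head_at_start s) y (head_at_end s)"
    using open_walk_directed_inducing[OF assms(3-5), of C] open_walk_sym
    by (auto simp: head_defs)
qed

text \<open>Separation by all other ancestors of \<open>{a, b}\<close> is only prevented by an inducing path: an open
  walk leaving these ancestors never returns, and inside them \<open>a\<close> is the only possible noncollider,
  so the part after the last noncollider is a collider path from \<open>a\<close>.\<close>

lemma open_walk_imp_inducing:
  fixes G :: "'a dmg" and a b :: 'a
  defines "S \<equiv> An G {a, b}"
  assumes wf: "wf_dmg G" and ab: "a \<in> nodes G" "b \<in> nodes G"
    and walk: "open_walk G (An G {a, b} - {a}) a h b True"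
  shows "(a, b) \<in> (bidir_on G S)\<^sup>+ \<or> (\<exists>x. Dir a x \<in> edges G \<and> x \<in> S \<and> (x, b) \<in> (bidir_on G S)\<^sup>*)"
proof -
  let ?C = "S - {a}"
  \<comment> \<open>A good node is reached from \<open>a\<close> with a head by a collider path
    inside \<open>S\<close> on which only the first edge may be directed.\<close>
  define good where "good v \<longleftrightarrow> (a, v) \<in> (bidir_on G S)\<^sup>+ \<or>
    (\<exists>x. Dir a x \<in> edges G \<and> x \<in> S \<and> (x, v) \<in> (bidir_on G S)\<^sup>*)" for v
  have a: "a \<in> S" and b: "b \<in> S" using ab by (auto simp: S_def intro: An_self)
  have An_C: "An G ?C \<subseteq> S"
    unfolding S_def using An_trans by (metis Diff_subset subsetI)
  have S_step: "x \<in> S" if "Dir x y \<in> edges G" "y \<in> S" for x y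
    using An_step that wf unfolding S_def by fastforce
  have good_start: "good v" if "step_edge s a v \<in> edges G" "v \<in> S" "head_at_end s" for s v
    using that a by (cases s) (auto simp: good_def head_defs bidir_on_def)
  have good_step: "good w" if "good v" "(v, w) \<in> bidir_on G S" for v w
    using that unfolding good_def by (meson rtrancl.rtrancl_into_rtrancl trancl.trancl_into_trancl)
  have inv: "(v \<notin> S \<and> k) \<or> (v \<in> S \<and> (k \<longrightarrow> good v))" if "open_walk G ?C w h v k" "w = a" for w v h k
    using that
  proof (induction rule: open_walk.induct)
    case (single s w v)
    then show ?case
      using a good_start[of s v] S_step[of v a] by (cases s) (auto simp: head_defs)
  next
    case (snoc w h x k s v)
    show ?case
    proof (cases "x \<in> S")
      case False
      \<comment> \<open>Outside \<open>S\<close> no node is an ancestor of \<open>?C\<close>, so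
        \<open>x\<close> cannot be a collider. Having arrived with a head, the walk leaves
        \<open>x\<close> by a tail, towards a node that is again outside \<open>S\<close>.\<close>
      then have "k" "s = Fwd"
        using snoc An_C by (auto simp: passable_def head_defs split: if_splits) (metis step.exhaust)
      then show ?thesis using False S_step[of x v] snoc.hyps by (auto simp: head_defs)
    next
      case True
      show ?thesis
      proof (cases "k \<and> head_at_start s")
        case col: True
        then have "good x" using snoc True by blast
        then show ?thesis
          using col snoc.hyps True S_step[of v x] good_step[of x v]
          by (cases s) (auto simp: head_defs bidir_on_def)
      next
        case False
        then have "x = a" using snoc.hyps(3) True by (auto simp: passable_def)
        then show ?thesis
          using a good_start[of s v] S_step[of v a] snoc.hyps by (cases s) (auto simp: head_defs)
      qed
    qed
  qed
  show ?thesis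
    using inv[of a h b True] walk b unfolding good_def S_def by auto
qed

section \<open>Deleting a bidirected edge of a maximal graph\<close>

locale maximal_bidirected =
  fixes N :: "'a dmg" and \<alpha> \<beta> :: 'a
  assumes wf: "wf_dmg N" and maximal: "maximal_dmg N"
    and edge: "Bidir (Upair \<alpha> \<beta>) \<in> edges N"
begin

abbreviation "e \<equiv> Bidir (Upair \<alpha> \<beta>)"
abbreviation "M \<equiv> del_edge N e"

lemma wf_M: "wf_dmg M"
  using wf by (auto simp: wf_dmg_def del_edge_def)

lemma nodes_M: "nodes M = nodes N"
  by (simp add: del_edge_def)

lemma edges_M: "edges M = edges N - {e}"
  by (simp add: del_edge_def)

lemma An_M: "An M C = An N C"
  by (rule An_cong_Dir) (auto simp: del_edge_def)

lemma endpoints: "\<alpha> \<in> nodes N" "\<beta> \<in> nodes N"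
  using edge wf by (auto simp: wf_dmg_def all_edges_def)

lemma swap_edge: "Bidir (Upair \<beta> \<alpha>) = e"
  by auto

lemma swap: "maximal_bidirected N \<beta> \<alpha>"
  using wf maximal edge by unfold_locales (simp_all add: swap_edge)

text \<open>If the last edge is \<open>x -> \<alpha>\<close> or \<open>x <-> \<alpha>\<close>,
  maximality gives an edge of the same kind from \<open>x\<close> to \<open>\<beta>\<close>. It
  differs from \<open>e\<close> unless the last edge is the bidirected loop at
  \<open>\<alpha>\<close>.\<close>

lemma redirect:
  assumes "\<alpha> \<in> An N {\<beta>}" "\<alpha> \<in> C" "open_walk M C \<gamma> h v True" "\<gamma> \<notin> C" "v = \<alpha>"
  shows "\<exists>h'. open_walk M C \<gamma> h' \<beta> True"
proof -
  have step: "head_at_end s \<and> (x = \<alpha> \<and> s = Both \<or> step_edge s x \<beta> \<in> edges M)"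
    if "step_edge s x \<alpha> \<in> edges M" "head_at_end s" for s x
  proof (cases s)
    case Fwd
    then show ?thesis
      using that maximal_DirI[OF wf maximal _ edge assms(1), of x] by (auto simp: edges_M)
  next
    case Bwd
    then show ?thesis using that by (simp add: head_defs)
  next
    case Both
    then have xa: "Bidir (Upair x \<alpha>) \<in> edges N" using that by (simp add: edges_M)
    then have "x \<in> nodes N" using wf by (auto simp: wf_dmg_def all_edges_def)
    then have "x \<in> An N {x, \<beta>}" "\<alpha> \<in> An N {x, \<beta>}" "\<beta> \<in> An N {x, \<beta>}"
      using assms(1) endpoints An_mono[of "{\<beta>}" "{x, \<beta>}" N] by (auto intro: An_self)
    then have "(x, \<alpha>) \<in> bidir_on N (An N {x, \<beta>})" "(\<alpha>, \<beta>) \<in> bidir_on N (An N {x, \<beta>})"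
      using xa edge by (auto simp: bidir_on_def)
    then have "Bidir (Upair x \<beta>) \<in> edges N"
      by (intro maximal_BidirI[OF wf maximal]) auto
    then show ?thesis using Both that by (auto simp: edges_M)
  qed
  have "k \<Longrightarrow> v = \<alpha> \<Longrightarrow> \<gamma> \<notin> C \<Longrightarrow> \<exists>h'. open_walk M C \<gamma> h' \<beta> True"
    if "open_walk M C \<gamma> h v k" for \<gamma> h v k
    using that
  proof (induction rule: open_walk.induct)
    case (single s \<gamma> v)
    then show ?case using step[of s \<gamma>] assms(2) by (metis open_walk.single)
  next
    case (snoc \<gamma> h x k s v)
    show ?case
    proof (cases "step_edge s x \<beta> \<in> edges M")
      case True
      have "open_walk M C \<gamma> h \<beta> (head_at_end s)"
        using snoc.hyps(1) True snoc.hyps(3) by (rule open_walk.snoc)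
      then show ?thesis using snoc.prems by auto
    next
      case False
      \<comment> \<open>The final loop is dropped: \<open>\<alpha>\<close> lies in \<open>C\<close>,
        so it is passed as a collider and the shorter walk still arrives with a head.\<close>
      then have "x = \<alpha>" using step[of s x] snoc by auto
      moreover from this have "k" using snoc.hyps(3) assms(2) by (auto simp: passable_def split: if_splits)
      ultimately show ?thesis using snoc.IH snoc.prems by blast
    qed
  qed
  then show ?thesis using assms(3-5) by blast
qed

end

section \<open>Replacing the edge between inseparable endpoints\<close>

locale mutually_inseparable = maximal_bidirected +
  assumes u1: "\<alpha> \<in> u (nodes N) \<beta> (indep_model M)"
    and u2: "\<beta> \<in> u (nodes N) \<alpha> (indep_model M)"
begin

lemma swap_inseparable: "mutually_inseparable N \<beta> \<alpha>"
  using swap u1 u2 by (simp add: mutually_inseparable_def mutually_inseparable_axioms_def swap_edge)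

lemma open_walk_between:
  assumes "\<alpha> \<notin> C" "C \<subseteq> nodes N"
  shows "\<exists>h. open_walk M C \<alpha> h \<beta> True"
  using u1 in_u_iff[OF wf_M, of \<alpha> \<beta>] endpoints assms nodes_M by (simp add: subset_Diff_insert)

lemma inducing:
  "(\<alpha>, \<beta>) \<in> (bidir_on M (An N {\<alpha>, \<beta>}))\<^sup>+ \<or>
   (\<exists>x. Dir \<alpha> x \<in> edges N \<and> x \<in> An N {\<alpha>, \<beta>} \<and> (x, \<beta>) \<in> (bidir_on M (An N {\<alpha>, \<beta>}))\<^sup>*)"
proof -
  have "An N {\<alpha>, \<beta>} - {\<alpha>} \<subseteq> nodes N" by (auto simp: An_def)
  then obtain h where "open_walk M (An N {\<alpha>, \<beta>} - {\<alpha>}) \<alpha> h \<beta> True"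
    using open_walk_between by blast
  then show ?thesis
    using open_walk_imp_inducing[OF wf_M, of \<alpha> \<beta>] endpoints by (simp add: nodes_M An_M edges_M)
qed

text \<open>Otherwise the inducing path starts with some \<open>\<alpha> -> x\<close>. Prolonging it
  by \<open>e\<close> gives inducing paths in \<open>N\<close>; the bidirected edges that maximality
  derives from them avoid \<open>e\<close> and join \<open>\<alpha>\<close> to
  \<open>\<beta>\<close> after all.\<close>

lemma bidirected_inducing:
  assumes "\<alpha> \<notin> An N {\<beta>}"
  shows "(\<alpha>, \<beta>) \<in> (bidir_on M (An N {\<alpha>, \<beta>}))\<^sup>+"
proof (rule ccontr)
  let ?S = "An N {\<alpha>, \<beta>}"
  let ?B = "bidir_on M ?S" and ?B' = "bidir_on N ?S"
  assume no: "(\<alpha>, \<beta>) \<notin> ?B\<^sup>+"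
  have ne: "\<alpha> \<noteq> \<beta>" using assms endpoints An_self by fastforce
  have S: "\<alpha> \<in> ?S" "\<beta> \<in> ?S" using endpoints by (auto intro: An_self)
  have S_split: "?S = An N {\<alpha>} \<union> An N {\<beta>}" by (rule An_insert)
  have B_le: "?B\<^sup>* \<subseteq> ?B'\<^sup>*" by (intro rtrancl_mono bidir_on_mono) (auto simp: edges_M)
  have e: "(\<alpha>, \<beta>) \<in> ?B'" using edge S by (simp add: bidir_on_def)
  have no': "(\<alpha>, \<beta>) \<notin> ?B\<^sup>*" using no ne by (simp add: rtrancl_eq_or_trancl)
  have BI: "Bidir (Upair p q) \<in> edges N" if "(p, q) \<in> ?B'\<^sup>+" "?S \<subseteq> An N {p, q}" for p q
    using that maximal_BidirI[OF wf maximal] trancl_mono_subset bidir_on_mono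
    by (metis order_refl subsetD)
  obtain x where x: "Dir \<alpha> x \<in> edges N" "x \<in> ?S" "(x, \<beta>) \<in> ?B\<^sup>*"
    using inducing no by blast
  \<comment> \<open>If \<open>x\<close> were an ancestor of \<open>\<beta>\<close>, then so would be
    \<open>\<alpha>\<close>.\<close>
  have x_An: "x \<in> An N {\<alpha>}" "x \<notin> An N {\<beta>}"
    using x assms An_step[OF x(1) _ wf] S_split by auto
  have xne: "x \<noteq> \<beta>" "x \<noteq> \<alpha>" using x_An no' x endpoints An_self[of \<beta> N] by auto
  have \<alpha>_x: "\<alpha> \<in> An N {x}"
    using An_nodes[OF x(2)] by (rule An_step[OF x(1) An_self wf]) simp
  have x\<alpha>: "(x, \<alpha>) \<in> ?B'\<^sup>+"
    using x(3) B_le bidir_on_sym[OF e] by (meson rtrancl_into_trancl1 subsetD)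
  show False
  proof (cases "\<beta> \<in> An N {\<alpha>}")
    case True
    \<comment> \<open>Now \<open>\<beta>\<close> is an ancestor of \<open>\<alpha>\<close>, so the
      path from \<open>x\<close> over \<open>\<beta>\<close> to \<open>\<alpha>\<close> is inducing.
      Its edge \<open>x <-> \<alpha>\<close> is not \<open>e\<close> because \<open>x\<close> is not
      \<open>\<beta>\<close>.\<close>
    have "?S \<subseteq> An N {x, \<alpha>}"
      using True An_trans[of _ N "{\<alpha>, \<beta>}" "{\<alpha>}"] An_mono[of "{\<alpha>}" "{x, \<alpha>}" N] endpoints
      by (auto intro: An_self)
    then have "Bidir (Upair x \<alpha>) \<in> edges N" using BI x\<alpha> by blast
    then have "(\<alpha>, x) \<in> ?B"
      using xne x S by (intro bidir_on_sym[of x]) (auto simp: bidir_on_def edges_M)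
    then show False using no x(3) by (meson rtrancl_into_trancl2)
  next
    case False
    interpret sw: mutually_inseparable N \<beta> \<alpha> by (rule swap_inseparable)
    have "(\<beta>, \<alpha>) \<notin> ?B\<^sup>+"
      using no' bidir_on_rtrancl_sym[OF trancl_into_rtrancl, of \<beta> \<alpha>] by auto
    then obtain y where y: "Dir \<beta> y \<in> edges N" "y \<in> ?S" "(y, \<alpha>) \<in> ?B\<^sup>*"
      using sw.inducing unfolding swap_edge insert_commute[of \<beta>] by blast
    have y_An: "y \<in> An N {\<beta>}" "y \<notin> An N {\<alpha>}"
      using y False An_step[OF y(1) _ wf] S_split by auto
    have yne: "y \<noteq> \<alpha>" using y_An endpoints An_self[of \<alpha> N] by auto
    have yne': "y \<noteq> \<beta>" using bidir_on_rtrancl_sym[OF y(3)] no' by auto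
    have \<beta>_y: "\<beta> \<in> An N {y}"
      using An_nodes[OF y(2)] by (rule An_step[OF y(1) An_self wf]) simp
    have \<alpha>y: "(\<alpha>, y) \<in> ?B'\<^sup>*" using bidir_on_rtrancl_sym[OF y(3)] B_le by (rule set_rev_mp)
    \<comment> \<open>Each endpoint may be exchanged for its child, \<open>\<alpha>\<close> for
      \<open>x\<close> and \<open>\<beta>\<close> for \<open>y\<close>, and the ancestors of the
      pair still cover \<open>?S\<close>.\<close>
    have sub: "?S \<subseteq> An N {p, q}" if "\<alpha> \<in> An N {p}" "\<beta> \<in> An N {q}" for p q
      using that An_trans[of _ N "{\<alpha>, \<beta>}" "{p, q}"] An_insert[of N p "{q}"] by auto
    have \<alpha>\<alpha>: "\<alpha> \<in> An N {\<alpha>}" and \<beta>\<beta>: "\<beta> \<in> An N {\<beta>}" using endpoints by (auto intro: An_self)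
    have "(\<alpha>, y) \<in> ?B'\<^sup>+" using \<alpha>y yne by (simp add: rtrancl_eq_or_trancl)
    moreover have "(x, y) \<in> ?B'\<^sup>+" using x\<alpha> \<alpha>y by (rule trancl_rtrancl_trancl)
    moreover have "(x, \<beta>) \<in> ?B'\<^sup>+" using x\<alpha> e by (rule trancl_into_trancl)
    ultimately have "Bidir (Upair \<alpha> y) \<in> edges N" "Bidir (Upair x y) \<in> edges N"
      "Bidir (Upair x \<beta>) \<in> edges N"
      using BI sub \<alpha>\<alpha> \<beta>\<beta> \<alpha>_x \<beta>_y by simp_all
    then have "(\<alpha>, y) \<in> ?B" "(x, y) \<in> ?B" "(x, \<beta>) \<in> ?B"
      using xne yne' x y S by (auto simp: bidir_on_def edges_M)
    \<comment> \<open>The path is \<open>\<alpha> <-> y <-> x <-> \<beta>\<close>.\<close>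
    then have "(\<alpha>, \<beta>) \<in> ?B\<^sup>+"
      by (meson bidir_on_sym[of x y] r_into_trancl' trancl_into_trancl)
    then show False using no by contradiction
  qed
qed

lemma extend_over_edge:
  assumes "\<alpha> \<in> C" "open_walk M C \<gamma> h \<alpha> True" "\<gamma> \<notin> C"
  shows "\<exists>h'. open_walk M C \<gamma> h' \<beta> True"
proof (cases "\<alpha> \<in> An N {\<beta>}")
  case True
  then show ?thesis using redirect assms by blast
next
  case False
  then have "open_walk M C \<alpha> True \<beta> True"
    using bidirected_inducing open_walk_bidirected_inducing[of \<alpha> \<beta> M] by (simp add: An_M)
  then show ?thesis
    using open_walk_trans[of M C \<alpha> True \<beta> True \<gamma> h True] assms endpoints
    by (auto simp: passable_def An_M intro: An_self)
qed

text \<open>The last premise is passability of \<open>\<alpha>\<close> when \<open>e\<close>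
  follows, since \<open>e\<close> has a head there. If \<open>\<alpha> \<notin> C\<close>, a
  substitute starting with a head leaves the status of \<open>\<alpha>\<close> unchanged, and one
  starting with a tail makes it a harmless noncollider.\<close>

lemma pass_edge:
  assumes "C \<subseteq> nodes N" "open_walk M C \<gamma> h \<alpha> k" "\<gamma> \<notin> C" "passable M C \<alpha> k"
  shows "\<exists>h'. open_walk M C \<gamma> h' \<beta> True"
proof (cases "\<alpha> \<in> C")
  case True
  then have k using assms(4) by (auto simp: passable_def split: if_splits)
  then show ?thesis using extend_over_edge True assms by simp
next
  case False
  then obtain h' where w: "open_walk M C \<alpha> h' \<beta> True" using open_walk_between assms(1) by blast
  have "passable M C \<alpha> (k \<and> h')" using False assms(4) by (simp add: passable_def)
  then show ?thesis using open_walk_trans[OF w assms(2)] by blast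
qed

text \<open>The head or tail at \<open>v\<close> is kept, so the next node passed has the same
  status as before. Only the mark at the start may change, and an endpoint cannot block.\<close>

lemma avoid_edge:
  assumes "C \<subseteq> nodes N" "open_walk N C \<gamma> h v k" "\<gamma> \<notin> C"
  shows "\<exists>h'. open_walk M C \<gamma> h' v k"
proof -
  interpret sw: mutually_inseparable N \<beta> \<alpha> by (rule swap_inseparable)
  have e_step: "s = Both \<and> (x = \<alpha> \<and> y = \<beta> \<or> x = \<beta> \<and> y = \<alpha>)" if "step_edge s x y = e" for s x y
    using that by (cases s) auto
  show ?thesis
    using assms(2,3)
  proof (induction rule: open_walk.induct)
    case (single s \<gamma> v)
    show ?case
    proof (cases "step_edge s \<gamma> v = e")
      case True
      then show ?thesis
        using e_step[OF True] open_walk_between[OF _ assms(1)] sw.open_walk_between[OF _ assms(1)]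
          single.prems
        by (auto simp: swap_edge head_defs)
    next
      case False
      then show ?thesis using single by (metis DiffI edges_M open_walk.single singletonD)
    qed
  next
    case (snoc \<gamma> h x k s v)
    then obtain h' where w: "open_walk M C \<gamma> h' x k" by blast
    have p: "passable M C x (k \<and> head_at_start s)"
      using snoc.hyps by (simp add: passable_def An_M)
    show ?case
    proof (cases "step_edge s x v = e")
      case True
      then show ?thesis
        using e_step[OF True] pass_edge[OF assms(1)] sw.pass_edge[OF assms(1)] w p snoc.prems
        by (auto simp: swap_edge head_defs)
    next
      case False
      then show ?thesis using snoc w p by (metis DiffI edges_M open_walk.snoc singletonD)
    qed
  qed
qed

end

theorem proposition5p12:
  fixes N :: "'a dmg" and \<alpha> \<beta> :: 'a and e :: "'a edge"
  assumes "wf_dmg N" and "maximal_dmg N"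
    and "\<alpha> \<in> nodes N" and "\<beta> \<in> nodes N"
    and "e = Bidir (Upair \<alpha> \<beta>)" and "e \<in> edges N"
  shows "markov_equivalent (del_edge N e) N \<longleftrightarrow>
      \<alpha> \<in> u (nodes N) \<beta> (indep_model (del_edge N e)) \<and>
      \<beta> \<in> u (nodes N) \<alpha> (indep_model (del_edge N e))"
proof
  assume "markov_equivalent (del_edge N e) N"
  then have "indep_model (del_edge N e) = indep_model N" by (simp add: markov_equivalent_def)
  moreover have "Bidir (Upair \<beta> \<alpha>) \<in> edges N" using assms(5,6) by (metis Upair_inject)
  ultimately show "\<alpha> \<in> u (nodes N) \<beta> (indep_model (del_edge N e)) \<and>
      \<beta> \<in> u (nodes N) \<alpha> (indep_model (del_edge N e))"
    using Bidir_imp_in_u[OF assms(1)] assms(5,6) by simp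
next
  assume u: "\<alpha> \<in> u (nodes N) \<beta> (indep_model (del_edge N e)) \<and>
      \<beta> \<in> u (nodes N) \<alpha> (indep_model (del_edge N e))"
  interpret mutually_inseparable N \<alpha> \<beta>
    using assms u by unfold_locales auto
  have "indep_model M = indep_model N"
  proof (rule indep_model_cong[OF wf_M wf nodes_M])
    fix a b C
    assume "a \<notin> C" "C \<subseteq> nodes M"
    moreover have "open_walk N C a h b True" if "open_walk M C a h b True" for h
      using that by (rule open_walk_subst) (auto simp: An_M edges_M intro: single)
    ultimately show "(\<exists>h. open_walk M C a h b True) \<longleftrightarrow> (\<exists>h. open_walk N C a h b True)"
      using avoid_edge[of C a _ b True] by (auto simp: nodes_M)
  qed
  then show "markov_equivalent (del_edge N e) N"
    using assms(5) nodes_M by (simp add: markov_equivalent_def)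
qed

end
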